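(* Let $\widehat{S^3} := \partial([-1,1]^4)\subset\mathbb{R}^4$ and let $\mu_3:\widehat{S^3}\to S^3$ be the homeomorphism $\mu_3(q)=q/\|q\|_2$. With $\widehat{S^3}$ and $S^3$ carrying the length distances induced from $\mathbb{R}^4$, the distance distortion range of $\mu_3$ is $$D_{\mu_3}=[\tfrac14,1].$$ Thus the distortion constant of $\mu_3$ is $C_0(\mu_3)=4$.
   Context: $S^3$ is the unit sphere in $\mathbb{R}^4$. Both $S^3$ and $\widehat{S^3}=\partial([-1,1]^4)$ (the boundary of the 4-cube, a union of 8 three-dimensional cubes) are regarded as metric spaces with the (piecewise) Riemannian metric induced from their inclusion in Euclidean $\mathbb{R}^4$: the distance between two points is the infimum of the Euclidean lengths of piecewise smooth curves joining them inside the space. (On $S^3$ this is the great-circle distance.) Distortion range: for metric spaces $(X,d_X)$, $(Y,d_Y)$ and a continuous map $f:X\to Y$, the distortion range $D_f$ is the closure in $\mathbb{R}$ of the set $\left\{\frac{d_Y(f(p),f(q))}{d_X(p,q)} : p,q\in X,\ p\ne q\right\}$. Distortion constant: if the distortion range of $f$ is $[a,b]$ (with $a>0$), then $C_0(f):=\max\{b,1/a\}$. *)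

theory Defs
  imports "HOL-Analysis.Analysis"
begin

definition smooth_on_interval :: "(real \<Rightarrow> 'a::real_normed_vector) \<Rightarrow> real \<Rightarrow> real \<Rightarrow> bool" where
  "smooth_on_interval g a b \<longleftrightarrow>
     (\<exists>D. D 0 = g \<and>
       (\<forall>k::nat. \<forall>t\<in>{a..b}. (D k has_vector_derivative D (Suc k) t) (at t within {a..b})))"

text \<open>
  The pieces are smooth on closed intervals, with one-sided derivatives at the breakpoints.
  The library's \<^const>\<open>piecewise_C1_differentiable_on\<close> only controls the derivative away from
  the breakpoints. It thus admits curves of infinite length, to which the (totalised) integral in
  the definition of \<open>curve_length\<close> would assign the length 0.
\<close>

definition piecewise_smooth_path :: "(real \<Rightarrow> 'a::real_normed_vector) \<Rightarrow> bool" where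
  "piecewise_smooth_path g \<longleftrightarrow>
     path g \<and>
     (\<exists>(n::nat) (c::nat \<Rightarrow> real). c 0 = 0 \<and> c n = 1 \<and>
       (\<forall>k<n. c k < c (Suc k) \<and> smooth_on_interval g (c k) (c (Suc k))))"

definition curve_length :: "(real \<Rightarrow> 'a::real_normed_vector) \<Rightarrow> real" where
  "curve_length g = integral {0..1} (\<lambda>t. norm (vector_derivative g (at t)))"

text \<open>
  The infimum is a real one, so it is only meaningful for points that some piecewise smooth curve
  inside \<open>X\<close> joins.
\<close>

definition length_dist :: "'a::real_normed_vector set \<Rightarrow> 'a \<Rightarrow> 'a \<Rightarrow> real" where
  "length_dist X p q =
     Inf {curve_length g | g. piecewise_smooth_path g \<and> path_image g \<subseteq> X \<and>
                              pathstart g = p \<and> pathfinish g = q}"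

definition distortion_range ::
    "'a set \<Rightarrow> ('a \<Rightarrow> 'a \<Rightarrow> real) \<Rightarrow> ('b \<Rightarrow> 'b \<Rightarrow> real) \<Rightarrow> ('a \<Rightarrow> 'b) \<Rightarrow> real set" where
  "distortion_range X dX dY f =
     closure {dY (f p) (f q) / dX p q | p q. p \<in> X \<and> q \<in> X \<and> p \<noteq> q}"

definition distortion_constant ::
    "'a set \<Rightarrow> ('a \<Rightarrow> 'a \<Rightarrow> real) \<Rightarrow> ('b \<Rightarrow> 'b \<Rightarrow> real) \<Rightarrow> ('a \<Rightarrow> 'b) \<Rightarrow> real" where
  "distortion_constant X dX dY f =
     (THE C. \<exists>a b. 0 < a \<and> a \<le> b \<and> distortion_range X dX dY f = {a..b} \<and> C = max b (1 / a))"

lemma distortion_constant_eq: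
  assumes "0 < a" "a \<le> b" "distortion_range X dX dY f = {a..b}"
  shows "distortion_constant X dX dY f = max b (1 / a)"
  unfolding distortion_constant_def
  by (rule the_equality) (use assms in \<open>auto simp: Icc_eq_Icc\<close>)

abbreviation S3 :: "(real^4) set" where
  "S3 \<equiv> sphere 0 1"

definition cube_S3 :: "(real^4) set" where
  "cube_S3 = frontier {x. \<forall>i. x $ i \<in> {-1..1}}"

definition mu3 :: "real^4 \<Rightarrow> real^4" where
  "mu3 q = q /\<^sub>R norm q"

lemma cube_S3_eq: "cube_S3 = {x. (\<forall>i. \<bar>x $ i\<bar> \<le> 1) \<and> (\<exists>i. \<bar>x $ i\<bar> = 1)}"
proof -
  have c: "{x :: real^4. \<forall>i. x $ i \<in> {-1..1}} = cbox (-1) 1"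
    by (auto simp: mem_box_cart)
  have b: "box (-1) 1 = {x :: real^4. \<forall>i. \<bar>x $ i\<bar> < 1}"
    unfolding set_eq_iff mem_box_cart mem_Collect_eq abs_less_iff
    by (simp add: minus_less_iff conj_commute)
  have b': "cbox (-1) 1 = {x :: real^4. \<forall>i. \<bar>x $ i\<bar> \<le> 1}"
    unfolding set_eq_iff mem_box_cart mem_Collect_eq abs_le_iff
    by (simp add: minus_le_iff conj_commute)
  have "cube_S3 = cbox (-1) 1 - box (-1) 1"
    unfolding cube_S3_def c frontier_cbox ..
  then show ?thesis
    unfolding b b' by (auto simp: order_less_le)
qed

lemma mu3_homeomorphism: "\<exists>g. homeomorphism cube_S3 S3 mu3 g"
proof (rule homeomorphism_compact)
  have nz: "x \<noteq> 0" if "x \<in> cube_S3" for x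
    using that by (auto simp: cube_S3_eq)
  have "{x :: real^4. \<forall>i. x $ i \<in> {-1..1}} = cbox (-1) 1"
    by (auto simp: mem_box_cart)
  then show "compact cube_S3"
    unfolding cube_S3_def by (simp add: compact_frontier_bounded bounded_cbox)
  show "continuous_on cube_S3 mu3"
    unfolding mu3_def by (intro continuous_intros) (use nz in auto)
  show "inj_on mu3 cube_S3"
  proof (rule inj_onI)
    fix x y assume x: "x \<in> cube_S3" and y: "y \<in> cube_S3" and e: "mu3 x = mu3 y"
    define c where "c = norm x / norm y"
    have c: "c > 0" using nz[OF x] nz[OF y] by (simp add: c_def)
    have "norm x *\<^sub>R mu3 x = x" using nz[OF x] by (simp add: mu3_def)
    then have xc: "x = c *\<^sub>R y"
      unfolding e by (simp add: mu3_def c_def divide_inverse)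
    obtain i j where "\<bar>x $ i\<bar> = 1" "\<bar>y $ j\<bar> = 1" "\<bar>y $ i\<bar> \<le> 1" "\<bar>x $ j\<bar> \<le> 1"
      using x y by (auto simp: cube_S3_eq)
    then have "c * \<bar>y $ i\<bar> = 1" "c \<le> 1" "\<bar>y $ i\<bar> \<le> 1"
      using c unfolding xc by (auto simp: abs_mult)
    then have "c = 1" using c mult_left_le[of "\<bar>y $ i\<bar>" c] by auto
    then show "x = y" using xc by simp
  qed
  show "mu3 ` cube_S3 = S3"
  proof
    show "mu3 ` cube_S3 \<subseteq> S3" using nz by (auto simp: mu3_def)
    show "S3 \<subseteq> mu3 ` cube_S3"
    proof
      fix p :: "real^4" assume p: "p \<in> S3"
      define m where "m = Max (range (\<lambda>i. \<bar>p $ i\<bar>))"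
      have le: "\<bar>p $ i\<bar> \<le> m" for i unfolding m_def by (rule Max_ge) auto
      have "m \<in> range (\<lambda>i. \<bar>p $ i\<bar>)" unfolding m_def by (rule Max_in) auto
      then obtain i where i: "m = \<bar>p $ i\<bar>" by auto
      have "m \<noteq> 0"
      proof
        assume "m = 0"
        then have "p = 0" using le by (simp add: vec_eq_iff)
        then show False using p by simp
      qed
      then have m: "m > 0" using i by simp
      have "p /\<^sub>R m \<in> cube_S3"
        using le m i by (auto simp: cube_S3_eq abs_mult field_simps intro!: exI[of _ i])
      moreover have "mu3 (p /\<^sub>R m) = p"
        using p m by (simp add: mu3_def)
      ultimately show "p \<in> mu3 ` cube_S3" by force
    qed
  qed
qed

end

theory Submission imports Defs begin

text \<open>
  The length distance of \<open>S3\<close> is the angle \<open>ang\<close>, and \<open>length_dist S3 (mu3 p) (mu3 q) = ang p q\<close> because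
  \<open>mu3\<close> preserves rays. A curve that stays outside the open unit ball is at least as long as the angle
  between its endpoints, so the ratio is at most 1. Two points \<open>p\<close>, \<open>q\<close> of one face satisfy
  \<open>norm (q - p) \<le> norm p * norm q * sin (ang p q) \<le> 4 * ang p q\<close>; summing this along the pieces that
  the faces cut out of a great circle arc bounds the distance on the cube by 4 times the angle, so the
  ratio is at least 1/4. All values in between are infinitesimal distortions along the diagonal of a
  face, from its centre (ratio 1) to a vertex (ratio 1/4).
\<close>

section \<open>Smoothness, speed and length of curves\<close>

lemma smooth_on_interval_cong:
  assumes "smooth_on_interval g a b" and eq: "\<And>t. t \<in> {a..b} \<Longrightarrow> h t = g t"
  shows "smooth_on_interval h a b"
proof -
  obtain D where D: "D 0 = g"
    "\<And>k t. t \<in> {a..b} \<Longrightarrow> (D k has_vector_derivative D (Suc k) t) (at t within {a..b})"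
    using assms(1) unfolding smooth_on_interval_def by blast
  \<comment> \<open>\<open>D 0\<close> must equal the curve as a function on all reals, so it is
    replaced by \<open>h\<close>; the higher derivatives can stay.\<close>
  have "((D(0 := h)) k has_vector_derivative (D(0 := h)) (Suc k) t) (at t within {a..b})"
    if "t \<in> {a..b}" for k t
  proof (cases k)
    case 0
    then show ?thesis
      using D(2)[OF that, of 0] D(1) has_vector_derivative_transform[OF that eq] by simp
  next
    case (Suc m)
    then show ?thesis
      using D(2)[OF that, of k] by simp
  qed
  then show ?thesis
    unfolding smooth_on_interval_def by (intro exI[of _ "D(0 := h)"]) auto
qed

lemma smooth_on_interval_affine:
  assumes "smooth_on_interval g (m * a + b) (m * c + b)" "m > 0"
  shows "smooth_on_interval (\<lambda>t. g (m * t + b)) a c"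
proof -
  obtain D where D: "D 0 = g"
    "\<And>k t. t \<in> {m * a + b..m * c + b} \<Longrightarrow>
      (D k has_vector_derivative D (Suc k) t) (at t within {m * a + b..m * c + b})"
    using assms(1) unfolding smooth_on_interval_def by blast
  \<comment> \<open>The chain rule contributes one factor \<open>m\<close> per derivative.\<close>
  have "((\<lambda>t. m ^ k *\<^sub>R D k (m * t + b)) has_vector_derivative m ^ Suc k *\<^sub>R D (Suc k) (m * t + b))
      (at t within {a..c})" if t: "t \<in> {a..c}" for k t
  proof -
    have 1: "((\<lambda>t. m * t + b) has_vector_derivative m) (at t within {a..c})"
      by (auto intro!: derivative_eq_intros simp: has_real_derivative_iff_has_vector_derivative[symmetric])
    have "(\<lambda>t. m * t + b) ` {a..c} \<subseteq> {m * a + b..m * c + b}"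
      using \<open>m > 0\<close> by auto
    moreover have "m * t + b \<in> {m * a + b..m * c + b}"
      using t \<open>m > 0\<close> by auto
    ultimately have "(D k has_vector_derivative D (Suc k) (m * t + b))
        (at (m * t + b) within (\<lambda>t. m * t + b) ` {a..c})"
      using D(2) has_vector_derivative_within_subset by blast
    from vector_diff_chain_within[OF 1 this]
    have "((\<lambda>t. D k (m * t + b)) has_vector_derivative m *\<^sub>R D (Suc k) (m * t + b)) (at t within {a..c})"
      by (simp add: o_def)
    from has_vector_derivative_scaleR[OF DERIV_const this, of "m ^ k"]
    show ?thesis by (simp add: mult.commute)
  qed
  then show ?thesis
    unfolding smooth_on_interval_def using D(1)
    by (intro exI[of _ "\<lambda>k t. m ^ k *\<^sub>R D k (m * t + b)"]) auto
qed

lemma smooth_on_interval_linear: "smooth_on_interval (\<lambda>t. p + t *\<^sub>R v) a b"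
  unfolding smooth_on_interval_def
proof (intro exI conjI allI ballI)
  let ?D = "\<lambda>k::nat. case k of 0 \<Rightarrow> (\<lambda>t. p + t *\<^sub>R v) | Suc 0 \<Rightarrow> (\<lambda>_. v) | _ \<Rightarrow> (\<lambda>_. 0)"
  show "?D 0 = (\<lambda>t. p + t *\<^sub>R v)" by simp
  fix k :: nat and t assume "t \<in> {a..b}"
  show "(?D k has_vector_derivative ?D (Suc k) t) (at t within {a..b})"
    by (auto split: nat.split intro!: derivative_eq_intros)
qed

lemma smooth_on_interval_arc:
  "smooth_on_interval (\<lambda>t. cos (c * t) *\<^sub>R u + sin (c * t) *\<^sub>R v) a b"
  unfolding smooth_on_interval_def
proof (intro exI conjI allI ballI)
  \<comment> \<open>Each differentiation multiplies by \<open>c\<close> and advances the phase by a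
    quarter turn, which gives all derivatives in one formula.\<close>
  let ?D = "\<lambda>(k::nat) t. c ^ k *\<^sub>R (cos (c * t + k * (pi / 2)) *\<^sub>R u + sin (c * t + k * (pi / 2)) *\<^sub>R v)"
  show "?D 0 = (\<lambda>t. cos (c * t) *\<^sub>R u + sin (c * t) *\<^sub>R v)" by simp
  fix k :: nat and t assume "t \<in> {a..b}"
  have e: "c * t + real (Suc k) * (pi / 2) = (c * t + k * (pi / 2)) + pi / 2"
    by (simp add: field_simps)
  show "(?D k has_vector_derivative ?D (Suc k) t) (at t within {a..b})"
    unfolding e sin_add cos_add
    by (auto intro!: derivative_eq_intros simp: has_real_derivative_iff_has_vector_derivative[symmetric] algebra_simps)
qed

lemma piecewise_smooth_path_single:
  "smooth_on_interval g 0 1 \<Longrightarrow> path g \<Longrightarrow> piecewise_smooth_path g"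
  unfolding piecewise_smooth_path_def
  by (auto intro!: exI[of _ "1::nat"] exI[of _ "real"])

lemma breakpoints_mono:
  fixes c :: "nat \<Rightarrow> real"
  assumes "\<And>k. k < n \<Longrightarrow> c k < c (Suc k)" "i \<le> j" "j \<le> n"
  shows "c i \<le> c j"
  using assms(2,3)
proof (induction rule: dec_induct)
  case (step m)
  then show ?case using assms(1)[of m] by auto
qed simp

text \<open>At the two endpoints the two-sided derivative may fail to exist, so
  \<open>vector_derivative\<close> is not controlled there. Elsewhere the speed equals the
  continuous \<open>norm (D 1 t)\<close>, and two points do not affect integrability.\<close>

lemma smooth_on_interval_integrable_speed:
  fixes g :: "real \<Rightarrow> 'a::euclidean_space"
  assumes "smooth_on_interval g a b"
  shows "(\<lambda>t. norm (vector_derivative g (at t))) integrable_on {a..b}"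
    and "\<And>t. t \<in> {a<..<b} \<Longrightarrow> g differentiable (at t)"
proof -
  obtain D where D: "D 0 = g"
    "\<And>k t. t \<in> {a..b} \<Longrightarrow> (D k has_vector_derivative D (Suc k) t) (at t within {a..b})"
    using assms unfolding smooth_on_interval_def by blast
  have at: "(g has_vector_derivative D 1 t) (at t)" if "t \<in> {a<..<b}" for t
    using D(2)[of t 0] that by (simp add: D(1) at_within_Icc_at)
  then show "\<And>t. t \<in> {a<..<b} \<Longrightarrow> g differentiable (at t)"
    by (rule differentiableI_vector)
  have "continuous_on {a..b} (D 1)"
    using D(2) has_vector_derivative_continuous continuous_on_eq_continuous_within by blast
  then have "(\<lambda>t. norm (D 1 t)) integrable_on {a..b}"
    by (intro integrable_continuous_real continuous_on_norm)
  then show "(\<lambda>t. norm (vector_derivative g (at t))) integrable_on {a..b}"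
  proof (rule integrable_spike[OF _ negligible_finite[of "{a, b}"]])
    fix t assume "t \<in> {a..b} - {a, b}"
    then have "t \<in> {a<..<b}" by auto
    from vector_derivative_at[OF at[OF this]]
    show "norm (vector_derivative g (at t)) = norm (D 1 t)" by simp
  qed auto
qed

lemma piecewise_smooth_path_speed:
  fixes g :: "real \<Rightarrow> 'a::euclidean_space"
  assumes "piecewise_smooth_path g"
  shows "(\<lambda>t. norm (vector_derivative g (at t))) integrable_on {0..1}"
    and "\<exists>S. finite S \<and> (\<forall>t\<in>{0..1} - S. g differentiable (at t))"
proof -
  obtain n c where c: "c 0 = 0" "c n = 1" "\<And>k::nat. k < n \<Longrightarrow> c k < c (Suc k)"
    and s: "\<And>k. k < n \<Longrightarrow> smooth_on_interval g (c k) (c (Suc k))"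
    using assms unfolding piecewise_smooth_path_def by auto
  have *: "(\<lambda>t. norm (vector_derivative g (at t))) integrable_on {0..c m} \<and>
     (\<forall>t\<in>{0..c m} - c ` {..m}. g differentiable (at t))" if "m \<le> n" for m
    using that
  proof (induction m)
    case 0
    then show ?case using integrable_on_refl[of _ "0::real"] by (simp add: c(1))
  next
    case (Suc m)
    have "0 \<le> c m" "c m < c (Suc m)"
      using breakpoints_mono[of n c 0 m] c Suc.prems by auto
    moreover have "t \<in> {0..c m} - c ` {..m} \<or> t \<in> {c m<..<c (Suc m)}"
      if "t \<in> {0..c (Suc m)} - c ` {..Suc m}" for t
      using that by (auto simp: atMost_Suc)
    moreover note smooth_on_interval_integrable_speed[OF s, of m]
    ultimately show ?case
      using Suc Henstock_Kurzweil_Integration.integrable_combine[of 0 "c m" "c (Suc m)"]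
      by (meson Suc_leD Suc_le_lessD less_imp_le)
  qed
  from *[of n] c show "(\<lambda>t. norm (vector_derivative g (at t))) integrable_on {0..1}"
    and "\<exists>S. finite S \<and> (\<forall>t\<in>{0..1} - S. g differentiable (at t))"
    by (auto intro!: exI[of _ "c ` {..n}"])
qed

lemma curve_length_nonneg:
  fixes g :: "real \<Rightarrow> 'a::euclidean_space"
  shows "piecewise_smooth_path g \<Longrightarrow> 0 \<le> curve_length g"
  unfolding curve_length_def by (intro integral_nonneg piecewise_smooth_path_speed) auto

text \<open>The fundamental theorem of calculus tolerates the finitely many exceptional points
  because the curve is continuous. Arbitrary parameter intervals are allowed so that the bound can
  be applied to each part of a subdivision.\<close>

lemma norm_diff_le_integral_speed:
  fixes g :: "real \<Rightarrow> 'a::euclidean_space"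
  assumes g: "piecewise_smooth_path g" and st: "0 \<le> s" "s \<le> t" "t \<le> 1"
  shows "norm (g t - g s) \<le> integral {s..t} (\<lambda>x. norm (vector_derivative g (at x)))"
proof -
  obtain S where S: "finite S" "\<And>x. x \<in> {0..1} - S \<Longrightarrow> g differentiable (at x)"
    using piecewise_smooth_path_speed(2)[OF g] by blast
  have "continuous_on {s..t} g"
    using g st unfolding piecewise_smooth_path_def path_def
    by (auto elim: continuous_on_subset)
  then have i: "((\<lambda>x. vector_derivative g (at x)) has_integral g t - g s) {s..t}"
    using S st by (intro fundamental_theorem_of_calculus_interior_strong[of S])
      (auto simp: vector_derivative_works[symmetric])
  moreover have "(\<lambda>x. norm (vector_derivative g (at x))) integrable_on {s..t}"
    using piecewise_smooth_path_speed(1)[OF g] by (rule integrable_on_subinterval) (use st in auto)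
  ultimately have "norm (integral {s..t} (\<lambda>x. vector_derivative g (at x))) \<le>
      integral {s..t} (\<lambda>x. norm (vector_derivative g (at x)))"
    by (intro integral_norm_bound_integral) (auto simp: integrable_on_def)
  then show ?thesis using i by (simp add: integral_unique)
qed

lemma norm_diff_le_curve_length:
  fixes g :: "real \<Rightarrow> 'a::euclidean_space"
  assumes "piecewise_smooth_path g"
  shows "norm (pathfinish g - pathstart g) \<le> curve_length g"
  using norm_diff_le_integral_speed[OF assms, of 0 1]
  by (simp add: curve_length_def pathfinish_def pathstart_def)

text \<open>For curves of constant speed, such as segments and great circle arcs; the two endpoints
  do not affect the integral.\<close>

lemma curve_length_eq:
  fixes g :: "real \<Rightarrow> 'a::euclidean_space"
  assumes "\<And>t. t \<in> {0<..<1} \<Longrightarrow> (g has_vector_derivative g' t) (at t)"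
    and "\<And>t. t \<in> {0<..<1} \<Longrightarrow> norm (g' t) = L"
  shows "curve_length g = L"
proof -
  have "integral {0..1} (\<lambda>t. norm (vector_derivative g (at t))) = integral {0..1::real} (\<lambda>_. L)"
  proof (rule integral_spike[of "{0, 1}"])
    fix t :: real assume "t \<in> {0..1} - {0, 1}"
    then have "t \<in> {0<..<1}" by auto
    then show "L = norm (vector_derivative g (at t))"
      using vector_derivative_at[OF assms(1)] assms(2) by simp
  qed auto
  then show ?thesis by (simp add: curve_length_def)
qed

section \<open>Concatenation of curves\<close>

lemma piecewise_smooth_path_join:
  assumes "piecewise_smooth_path g1" "piecewise_smooth_path g2" "pathfinish g1 = pathstart g2"
  shows "piecewise_smooth_path (g1 +++ g2)"
proof -
  obtain n1 c1 where 1: "c1 0 = 0" "c1 n1 = 1" "\<And>k::nat. k < n1 \<Longrightarrow> c1 k < c1 (Suc k)"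
      "\<And>k. k < n1 \<Longrightarrow> smooth_on_interval g1 (c1 k) (c1 (Suc k))"
    using assms(1) unfolding piecewise_smooth_path_def by auto
  obtain n2 c2 where 2: "c2 0 = 0" "c2 n2 = 1" "\<And>k::nat. k < n2 \<Longrightarrow> c2 k < c2 (Suc k)"
      "\<And>k. k < n2 \<Longrightarrow> smooth_on_interval g2 (c2 k) (c2 (Suc k))"
    using assms(2) unfolding piecewise_smooth_path_def by auto
  \<comment> \<open>The breakpoints of \<open>g1\<close> are halved and those of \<open>g2\<close>
    moved into the second half; at \<open>k = n1\<close> both formulas give 1/2.\<close>
  define c where "c k = (if k \<le> n1 then c1 k / 2 else (c2 (k - n1) + 1) / 2)" for k
  have c_ge: "c k = (c2 (k - n1) + 1) / 2" if "k \<ge> n1" for k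
    using that 1(2) 2(1) by (cases "k = n1") (auto simp: c_def)
  have "c k < c (Suc k) \<and> smooth_on_interval (g1 +++ g2) (c k) (c (Suc k))"
    if k: "k < n1 + n2" for k
  proof (cases "k < n1")
    case True
    then have e: "c k = c1 k / 2" "c (Suc k) = c1 (Suc k) / 2" by (auto simp: c_def)
    have le: "c1 (Suc k) \<le> 1" using breakpoints_mono[of n1 c1 "Suc k" n1] 1 True by auto
    have "smooth_on_interval (\<lambda>t. g1 (2 * t + 0)) (c k) (c (Suc k))"
      by (rule smooth_on_interval_affine) (use 1(4)[OF True] in \<open>auto simp: e\<close>)
    then have "smooth_on_interval (g1 +++ g2) (c k) (c (Suc k))"
      by (rule smooth_on_interval_cong) (use le in \<open>auto simp: joinpaths_def e\<close>)
    then show ?thesis using 1(3)[OF True] by (simp add: e)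
  next
    case False
    then have e: "c k = (c2 (k - n1) + 1) / 2" "c (Suc k) = (c2 (Suc (k - n1)) + 1) / 2"
      using c_ge[of k] c_ge[of "Suc k"] by (auto simp: Suc_diff_le)
    have l: "k - n1 < n2" using k False by auto
    have ge: "0 \<le> c2 (k - n1)" using breakpoints_mono[of n2 c2 0 "k - n1"] 2 l by auto
    have "2 * c k + - 1 = c2 (k - n1)" "2 * c (Suc k) + - 1 = c2 (Suc (k - n1))"
      by (auto simp: e field_simps)
    then have "smooth_on_interval (\<lambda>t. g2 (2 * t + - 1)) (c k) (c (Suc k))"
      using 2(4)[OF l] by (intro smooth_on_interval_affine) simp_all
    then have "smooth_on_interval (g1 +++ g2) (c k) (c (Suc k))"
    proof (rule smooth_on_interval_cong)
      fix t assume "t \<in> {c k..c (Suc k)}"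
      then have "t \<ge> 1 / 2" using ge by (auto simp: e)
      then show "(g1 +++ g2) t = g2 (2 * t + - 1)"
      proof (cases "t = 1 / 2")
        \<comment> \<open>At the junction \<open>g1 +++ g2\<close> still evaluates
          \<open>g1\<close>, so the matching endpoints are needed here.\<close>
        case True
        show ?thesis
          using assms(3) unfolding True by (simp add: joinpaths_def pathfinish_def pathstart_def)
      qed (simp add: joinpaths_def)
    qed
    then show ?thesis using 2(3)[OF l] by (simp add: e)
  qed
  moreover have "c 0 = 0" "c (n1 + n2) = 1"
    using 1 2 c_ge[of "n1 + n2"] by (auto simp: c_def)
  moreover have "path (g1 +++ g2)"
    using assms by (auto simp: piecewise_smooth_path_def)
  ultimately show ?thesis
    unfolding piecewise_smooth_path_def by blast
qed

text \<open>Doubling the speed compensates for halving the parameter interval. On each half only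
  finitely many parameters are left out: the junction, the outer endpoint, and the rescaled points
  where \<open>g1\<close> or \<open>g2\<close> may not be differentiable.\<close>

lemma curve_length_join:
  fixes g1 g2 :: "real \<Rightarrow> 'a::euclidean_space"
  assumes g: "piecewise_smooth_path g1" "piecewise_smooth_path g2"
  shows "curve_length (g1 +++ g2) = curve_length g1 + curve_length g2"
proof -
  let ?v = "\<lambda>t. norm (vector_derivative (g1 +++ g2) (at t))"
  obtain S1 where S1: "finite S1" "\<And>x. x \<in> {0..1} - S1 \<Longrightarrow> g1 differentiable (at x)"
    using piecewise_smooth_path_speed(2)[OF g(1)] by blast
  obtain S2 where S2: "finite S2" "\<And>x. x \<in> {0..1} - S2 \<Longrightarrow> g2 differentiable (at x)"
    using piecewise_smooth_path_speed(2)[OF g(2)] by blast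
  have "((\<lambda>t. norm (vector_derivative g1 (at t))) has_integral curve_length g1) (cbox 0 1)"
    using piecewise_smooth_path_speed(1)[OF g(1)] by (simp add: curve_length_def has_integral_integral)
  from has_integral_affinity[OF this, of 2 0]
  have 1: "((\<lambda>t. 2 * norm (vector_derivative g1 (at (2 * t)))) has_integral curve_length g1) {0..1/2}"
    using has_integral_mult_right[of _ "curve_length g1 / 2" _ 2] by (simp add: image_affinity_atLeastAtMost_div)
  have "((\<lambda>t. norm (vector_derivative g2 (at t))) has_integral curve_length g2) (cbox 0 1)"
    using piecewise_smooth_path_speed(1)[OF g(2)] by (simp add: curve_length_def has_integral_integral)
  from has_integral_affinity[OF this, of 2 "-1"]
  have 2: "((\<lambda>t. 2 * norm (vector_derivative g2 (at (2 * t - 1)))) has_integral curve_length g2) {1/2..1}"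
    using has_integral_mult_right[of _ "curve_length g2 / 2" _ 2] by (simp add: image_affinity_atLeastAtMost_div)
  have "(?v has_integral curve_length g1) {0..1/2}"
  proof (rule has_integral_spike_finite[OF _ _ 1])
    show "finite (insert (1/2) (insert 0 ((\<lambda>x. x / 2) ` S1)))" using S1 by simp
    fix t :: real assume t: "t \<in> {0..1/2} - insert (1/2) (insert 0 ((\<lambda>x. x / 2) ` S1))"
    have "2 * t \<notin> S1"
      using t imageI[of "2 * t" S1 "\<lambda>x. x / 2"] by auto
    with t have "g1 differentiable (at (2 * t))" by (intro S1) auto
    then have d: "(g1 has_vector_derivative vector_derivative g1 (at (2 * t))) (at (2 * t))"
      by (simp add: vector_derivative_works)
    have "((\<lambda>t. 2 * t) has_vector_derivative 2) (at t)"
      by (auto intro!: derivative_eq_intros simp: has_real_derivative_iff_has_vector_derivative[symmetric])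
    from vector_diff_chain_at[OF this d]
    have "((\<lambda>t. g1 (2 * t)) has_vector_derivative 2 *\<^sub>R vector_derivative g1 (at (2 * t))) (at t)"
      by (simp add: o_def)
    \<comment> \<open>Agreement on an open neighbourhood carries the two-sided derivative over to
      the join; this is why 0 and 1/2 were excluded.\<close>
    then have "((g1 +++ g2) has_vector_derivative 2 *\<^sub>R vector_derivative g1 (at (2 * t))) (at t)"
      by (rule has_vector_derivative_transform_within_open[where S = "{0<..<1/2}"])
        (use t in \<open>auto simp: joinpaths_def\<close>)
    then show "?v t = 2 * norm (vector_derivative g1 (at (2 * t)))"
      by (simp add: vector_derivative_at)
  qed
  moreover have "(?v has_integral curve_length g2) {1/2..1}"
  proof (rule has_integral_spike_finite[OF _ _ 2])
    show "finite (insert (1/2) (insert 1 ((\<lambda>x. (x + 1) / 2) ` S2)))" using S2 by simp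
    fix t :: real assume t: "t \<in> {1/2..1} - insert (1/2) (insert 1 ((\<lambda>x. (x + 1) / 2) ` S2))"
    have "2 * t - 1 \<notin> S2"
      using t imageI[of "2 * t - 1" S2 "\<lambda>x. (x + 1) / 2"] by auto
    with t have "g2 differentiable (at (2 * t - 1))" by (intro S2) auto
    then have d: "(g2 has_vector_derivative vector_derivative g2 (at (2 * t - 1))) (at (2 * t - 1))"
      by (simp add: vector_derivative_works)
    have "((\<lambda>t. 2 * t - 1) has_vector_derivative 2) (at t)"
      by (auto intro!: derivative_eq_intros simp: has_real_derivative_iff_has_vector_derivative[symmetric])
    from vector_diff_chain_at[OF this d]
    have "((\<lambda>t. g2 (2 * t - 1)) has_vector_derivative 2 *\<^sub>R vector_derivative g2 (at (2 * t - 1))) (at t)"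
      by (simp add: o_def)
    then have "((g1 +++ g2) has_vector_derivative 2 *\<^sub>R vector_derivative g2 (at (2 * t - 1))) (at t)"
      by (rule has_vector_derivative_transform_within_open[where S = "{1/2<..<1}"])
        (use t in \<open>auto simp: joinpaths_def\<close>)
    then show "?v t = 2 * norm (vector_derivative g2 (at (2 * t - 1)))"
      by (simp add: vector_derivative_at)
  qed
  ultimately have "(?v has_integral curve_length g1 + curve_length g2) {0..1}"
    using has_integral_combine[of 0 "1/2" 1] by simp
  then show ?thesis
    by (simp add: curve_length_def integral_unique)
qed

section \<open>Estimates for the length distance\<close>

text \<open>Asking for length at most \<open>L\<close> rather than exactly \<open>L\<close> lets
  bounds be weakened and added. It also records that some admissible curve exists, so the infimum in
  \<open>length_dist\<close> is over a nonempty set.\<close>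

definition joinable :: "'a::real_normed_vector set \<Rightarrow> 'a \<Rightarrow> 'a \<Rightarrow> real \<Rightarrow> bool" where
  "joinable X p q L \<longleftrightarrow>
     (\<exists>g. piecewise_smooth_path g \<and> path_image g \<subseteq> X \<and> pathstart g = p \<and> pathfinish g = q \<and>
          curve_length g \<le> L)"

lemma joinable_trans:
  fixes X :: "'a::euclidean_space set"
  assumes "joinable X p q K" "joinable X q r L"
  shows "joinable X p r (K + L)"
proof -
  obtain g1 where 1: "piecewise_smooth_path g1" "path_image g1 \<subseteq> X" "pathstart g1 = p"
      "pathfinish g1 = q" "curve_length g1 \<le> K"
    using assms(1) unfolding joinable_def by blast
  obtain g2 where 2: "piecewise_smooth_path g2" "path_image g2 \<subseteq> X" "pathstart g2 = q"
      "pathfinish g2 = r" "curve_length g2 \<le> L"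
    using assms(2) unfolding joinable_def by blast
  show ?thesis unfolding joinable_def
    using 1 2 piecewise_smooth_path_join[of g1 g2] curve_length_join[of g1 g2] path_image_join_subset[of g1 g2]
    by (intro exI[of _ "g1 +++ g2"]) auto
qed

lemma length_dist_le:
  fixes X :: "'a::euclidean_space set"
  assumes "joinable X p q L"
  shows "length_dist X p q \<le> L"
proof -
  obtain g where g: "piecewise_smooth_path g" "path_image g \<subseteq> X" "pathstart g = p"
      "pathfinish g = q" "curve_length g \<le> L"
    using assms unfolding joinable_def by blast
  have "length_dist X p q \<le> curve_length g"
    unfolding length_dist_def
    by (rule cInf_lower) (use g curve_length_nonneg in \<open>auto intro!: bdd_belowI[of _ 0]\<close>)
  then show ?thesis using g by simp
qed

text \<open>The \<open>joinable\<close> hypothesis supplies nonemptiness: a lower bound of a set of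
  reals bounds its \<open>Inf\<close> only if the set has an element.\<close>

lemma length_dist_ge:
  fixes X :: "'a::euclidean_space set"
  assumes "joinable X p q L"
    and "\<And>g. piecewise_smooth_path g \<Longrightarrow> path_image g \<subseteq> X \<Longrightarrow> pathstart g = p \<Longrightarrow> pathfinish g = q
           \<Longrightarrow> K \<le> curve_length g"
  shows "K \<le> length_dist X p q"
  unfolding length_dist_def
  by (rule cInf_greatest) (use assms in \<open>auto simp: joinable_def\<close>)

lemma joinable_segment:
  fixes p q :: "'a::euclidean_space"
  assumes "closed_segment p q \<subseteq> X"
  shows "joinable X p q (norm (q - p))"
proof -
  have eq: "linepath p q = (\<lambda>t. p + t *\<^sub>R (q - p))"
    by (auto simp: linepath_def algebra_simps)
  have "piecewise_smooth_path (linepath p q)"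
    by (rule piecewise_smooth_path_single) (simp_all add: eq[symmetric] smooth_on_interval_linear[of p "q - p", folded eq])
  moreover have "curve_length (linepath p q) = norm (q - p)"
    by (rule curve_length_eq[OF has_vector_derivative_linepath_within]) auto
  ultimately show ?thesis
    unfolding joinable_def using assms by (intro exI[of _ "linepath p q"]) auto
qed

section \<open>Angles between vectors\<close>

text \<open>Normalising inside the definition makes the angle constant along rays, so it applies to
  points of the cube directly. If a vector is zero, the quotient is 0 by the convention for
  division, so the bounds and \<open>cos_ang\<close> hold for all vectors.\<close>

definition ang :: "'a::real_inner \<Rightarrow> 'a \<Rightarrow> real" where
  "ang x y = arccos (x \<bullet> y / (norm x * norm y))"

lemma abs_inner_quotient_le_1: "\<bar>x \<bullet> y / (norm x * norm y)\<bar> \<le> 1"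
  using Cauchy_Schwarz_ineq2[of x y] by (auto simp: divide_le_eq_1 abs_mult)

lemma ang_nonneg: "0 \<le> ang x y" and ang_le_pi: "ang x y \<le> pi"
  and cos_ang: "cos (ang x y) = x \<bullet> y / (norm x * norm y)"
  using abs_inner_quotient_le_1[of x y] unfolding abs_le_iff
  by (simp_all add: ang_def arccos_lbound arccos_ubound cos_arccos)

lemma inner_eq_cos_ang: "x \<bullet> y = norm x * norm y * cos (ang x y)"
  by (auto simp: cos_ang)

lemma ang_scale: "0 < a \<Longrightarrow> 0 < b \<Longrightarrow> ang (a *\<^sub>R x) (b *\<^sub>R y) = ang x y"
  by (simp add: ang_def)

lemma ang_refl: "x \<noteq> 0 \<Longrightarrow> ang x x = 0"
  by (simp add: ang_def dot_square_norm power2_eq_square)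

lemma sin_ang_nonneg: "0 \<le> sin (ang x y)"
  by (intro sin_ge_zero ang_nonneg ang_le_pi)

text \<open>Pythagoras: the part of \<open>v\<close> orthogonal to \<open>u\<close> has squared
  length 1 minus the squared cosine.\<close>

lemma norm_reject_unit:
  assumes "norm u = 1" "norm v = 1"
  shows "norm (v - (u \<bullet> v) *\<^sub>R u) = sin (ang u v)"
proof -
  have 1: "u \<bullet> u = 1" "v \<bullet> v = 1" using assms by (simp_all add: dot_square_norm)
  have "(norm (v - (u \<bullet> v) *\<^sub>R u))\<^sup>2 = 1 - (u \<bullet> v)\<^sup>2"
    unfolding power2_norm_eq_inner using 1
    by (simp add: inner_diff_left inner_diff_right inner_commute power2_eq_square)
  also have "\<dots> = (sin (ang u v))\<^sup>2"
    using assms by (simp add: sin_squared_eq cos_ang)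
  finally show ?thesis
    using sin_ang_nonneg[of u v] by (simp add: power2_eq_iff_nonneg)
qed

lemma ang_commute: "ang x y = ang y x"
  by (simp add: ang_def inner_commute mult.commute)

text \<open>Cauchy-Schwarz for the parts of \<open>u\<close> and \<open>w\<close> orthogonal to
  \<open>v\<close> gives \<open>cos (ang u v + ang v w) \<le> cos (ang u w)\<close>, and the cosine
  decreases between 0 and pi. A sum above pi is large enough anyway.\<close>

lemma ang_triangle_unit:
  assumes "norm u = 1" "norm v = 1" "norm w = 1"
  shows "ang u w \<le> ang u v + ang v w"
proof (cases "ang u v + ang v w \<le> pi")
  case True
  let ?a = "u - (v \<bullet> u) *\<^sub>R v" and ?b = "w - (v \<bullet> w) *\<^sub>R v"
  have "v \<bullet> v = 1" using assms by (simp add: dot_square_norm)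
  then have "?a \<bullet> ?b = u \<bullet> w - (v \<bullet> u) * (v \<bullet> w)"
    by (simp add: inner_diff_left inner_diff_right inner_commute)
  moreover have "- (?a \<bullet> ?b) \<le> norm ?a * norm ?b"
    using Cauchy_Schwarz_ineq2[of ?a ?b] by linarith
  moreover have "norm ?a = sin (ang u v)" "norm ?b = sin (ang v w)"
    using norm_reject_unit[of v u] norm_reject_unit[of v w] assms by (auto simp: ang_commute)
  moreover have "cos (ang u v) = v \<bullet> u" "cos (ang v w) = v \<bullet> w" "cos (ang u w) = u \<bullet> w"
    using assms by (auto simp: cos_ang inner_commute)
  ultimately have "cos (ang u v + ang v w) \<le> cos (ang u w)"
    by (simp add: cos_add)
  then show ?thesis
    using True ang_nonneg[of u v] ang_nonneg[of v w] ang_nonneg[of u w] ang_le_pi[of u w]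
    by (subst (asm) cos_mono_le_eq) auto
qed (use ang_le_pi[of u w] in linarith)

lemma ang_triangle:
  assumes "x \<noteq> 0" "y \<noteq> 0" "z \<noteq> 0"
  shows "ang x z \<le> ang x y + ang y z"
  using ang_triangle_unit[of "x /\<^sub>R norm x" "y /\<^sub>R norm y" "z /\<^sub>R norm z"] assms
  by (simp add: ang_scale)

section \<open>Angles and lengths outside the open unit ball\<close>

text \<open>Radial projection to the unit sphere does not lengthen a chord between points outside
  the open ball, and the projected chord is twice the sine of the half angle.\<close>

lemma chord_le:
  assumes "1 \<le> norm x" "1 \<le> norm y"
  shows "2 * sin (ang x y / 2) \<le> norm (x - y)"
proof (rule power2_le_imp_le)
  let ?a = "norm x" and ?b = "norm y" and ?c = "cos (ang x y)"
  have "cos (ang x y) = 1 - 2 * (sin (ang x y / 2))\<^sup>2"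
    using cos_double_sin[of "ang x y / 2"] by simp
  then have "(2 * sin (ang x y / 2))\<^sup>2 = 2 - 2 * ?c"
    by (simp add: power_mult_distrib)
  moreover have "(norm (x - y))\<^sup>2 = ?a\<^sup>2 + ?b\<^sup>2 - 2 * (?a * ?b * ?c)"
    by (simp only: inner_eq_cos_ang[symmetric] power2_norm_eq_inner)
      (simp add: inner_diff_left inner_diff_right inner_commute)
  \<comment> \<open>This expression is exactly the difference of the two squares. Its terms are
    nonnegative because both norms are at least 1 and the cosine is at most 1.\<close>
  moreover have "0 \<le> (?a - ?b)\<^sup>2 + 2 * ((?a * ?b - 1) * (1 - ?c))"
    using assms mult_mono[of 1 ?a 1 ?b] by (intro add_nonneg_nonneg mult_nonneg_nonneg) auto
  ultimately show "(2 * sin (ang x y / 2))\<^sup>2 \<le> (norm (x - y))\<^sup>2"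
    by (simp add: power2_diff algebra_simps)
qed simp

text \<open>A form of \<open>x \<le> tan x\<close>, itself from \<open>arctan y \<le> y\<close>,
  cleared of the denominator so that it also covers \<open>pi / 2\<close>.\<close>

lemma mult_cos_le_sin:
  assumes "0 \<le> x" "x \<le> pi / 2"
  shows "x * cos x \<le> sin x"
proof (cases "x = pi / 2")
  case False
  then have x: "x < pi / 2" using assms by simp
  then have c: "0 < cos x" using assms by (intro cos_gt_zero_pi) auto
  have "0 \<le> tan x" using assms x tan_gt_zero[of x] by (cases "x = 0") auto
  then have "x \<le> tan x"
    using arctan_le_self[of "tan x"] arctan_tan[of x] assms x by simp
  then show ?thesis using c by (simp add: tan_def field_simps)
next
  case True
  show ?thesis unfolding True by simp
qed

text \<open>A short chord forces a half angle \<open>h\<close> with \<open>cos h \<ge> k\<close>.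
  Then \<open>k * h \<le> h * cos h \<le> sin h\<close>, and the chord is at least
  \<open>2 * sin h\<close>.\<close>

lemma ang_le_chord:
  assumes xy: "1 \<le> norm x" "1 \<le> norm y" and k: "0 < k" "k < 1"
    and d: "norm (x - y) \<le> 2 * sqrt (1 - k\<^sup>2)"
  shows "k * ang x y \<le> norm (x - y)"
proof -
  let ?h = "ang x y / 2"
  have h: "0 \<le> ?h" "?h \<le> pi / 2" using ang_nonneg[of x y] ang_le_pi[of x y] by auto
  have "sin ?h \<le> sqrt (1 - k\<^sup>2)" "0 \<le> sin ?h"
    using chord_le[OF xy] d h by (auto intro!: sin_ge_zero)
  then have "(sin ?h)\<^sup>2 \<le> (sqrt (1 - k\<^sup>2))\<^sup>2" by (rule power_mono)
  also have "\<dots> = 1 - k\<^sup>2" using k by (simp add: power_le_one)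
  finally have "k\<^sup>2 \<le> (cos ?h)\<^sup>2" by (simp add: cos_squared_eq)
  then have "k \<le> cos ?h"
    using h by (intro power2_le_imp_le[of k] cos_ge_zero) auto
  then have "?h * k \<le> ?h * cos ?h" using h by (intro mult_left_mono) auto
  also have "\<dots> \<le> sin ?h" using h by (intro mult_cos_le_sin) auto
  finally show ?thesis using chord_le[OF xy] by (simp add: mult.commute)
qed

text \<open>
  Subdividing the curve finely makes all angles comparable to the chords, up to a factor close to 1.
\<close>

lemma ang_le_curve_length:
  fixes g :: "real \<Rightarrow> 'a::euclidean_space"
  assumes g: "piecewise_smooth_path g" and out: "\<And>t. t \<in> {0..1} \<Longrightarrow> 1 \<le> norm (g t)"
  shows "ang (pathstart g) (pathfinish g) \<le> curve_length g"
proof (rule field_le_mult_one_interval)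
  \<comment> \<open>It suffices to lose an arbitrary factor \<open>k < 1\<close>; the threshold of
    \<open>ang_le_chord\<close> for this \<open>k\<close> then fixes the mesh of the
    subdivision.\<close>
  fix k :: real assume k: "0 < k" "k < 1"
  let ?v = "\<lambda>x. norm (vector_derivative g (at x))"
  have nz: "g t \<noteq> 0" if "t \<in> {0..1}" for t using out[OF that] by auto
  have "uniformly_continuous_on {0..1} g"
    using g by (auto simp: piecewise_smooth_path_def path_def intro: compact_uniformly_continuous)
  moreover have "2 * sqrt (1 - k\<^sup>2) > 0" using k by (simp add: power_strict_mono[of k 1 2, simplified])
  ultimately obtain d where d: "d > 0"
    "\<And>s t. s \<in> {0..1} \<Longrightarrow> t \<in> {0..1} \<Longrightarrow> dist t s < d \<Longrightarrow> dist (g t) (g s) < 2 * sqrt (1 - k\<^sup>2)"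
    unfolding uniformly_continuous_on_def by metis
  obtain N :: nat where N: "N > 0" "1 / N < d"
    using d(1) nat_approx_posE by (metis of_nat_Suc zero_less_Suc)
  have "k * ang (g 0) (g (m / N)) \<le> integral {0..m / N} ?v" if "m \<le> N" for m
    using that
  proof (induction m)
    case 0
    then show ?case using nz[of 0] by (simp add: ang_refl)
  next
    case (Suc m)
    let ?s = "m / N" and ?t = "Suc m / N"
    have st: "0 \<le> ?s" "?s \<le> ?t" "?t \<le> 1" "?s \<in> {0..1}" "?t \<in> {0..1}" "?t - ?s = 1 / N"
      using Suc.prems N(1) by (auto simp: field_simps)
    have "norm (g ?s - g ?t) \<le> 2 * sqrt (1 - k\<^sup>2)"
      using d(2)[of ?t ?s] st N(2) by (simp add: dist_norm less_imp_le)
    then have "k * ang (g ?s) (g ?t) \<le> norm (g ?t - g ?s)"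
      using ang_le_chord[of "g ?s" "g ?t" k] k out st by (simp add: norm_minus_commute)
    also have "\<dots> \<le> integral {?s..?t} ?v"
      using norm_diff_le_integral_speed[OF g] st by blast
    finally have 1: "k * ang (g ?s) (g ?t) \<le> integral {?s..?t} ?v" .
    have "k * ang (g 0) (g ?t) \<le> k * (ang (g 0) (g ?s) + ang (g ?s) (g ?t))"
      using k nz st by (intro mult_left_mono ang_triangle) auto
    also have "\<dots> \<le> integral {0..?s} ?v + integral {?s..?t} ?v"
      using 1 Suc by (simp add: distrib_left)
    also have "\<dots> = integral {0..?t} ?v"
      using st by (intro Henstock_Kurzweil_Integration.integral_combine
          integrable_on_subinterval[OF piecewise_smooth_path_speed(1)[OF g]]) auto
    finally show ?case .
  qed
  from this[of N] N(1) show "k * ang (pathstart g) (pathfinish g) \<le> curve_length g"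
    by (simp add: curve_length_def pathstart_def pathfinish_def)
qed

section \<open>Great circles and the length distance of the sphere\<close>

text \<open>For orthonormal \<open>u\<close> and \<open>w\<close> this is the unit-speed great
  circle starting at \<open>u\<close> in direction \<open>w\<close>.\<close>

definition great_arc :: "'a::real_inner \<Rightarrow> 'a \<Rightarrow> real \<Rightarrow> 'a" where
  "great_arc u w t = cos t *\<^sub>R u + sin t *\<^sub>R w"

lemma unit_eq_great_arc:
  fixes u v :: "'a::euclidean_space"
  assumes "2 \<le> DIM('a)" and u: "norm u = 1" and v: "norm v = 1"
  obtains w where "norm w = 1" "u \<bullet> w = 0" "v = great_arc u w (ang u v)"
proof (cases "sin (ang u v) = 0")
  case False
  let ?w = "(v - (u \<bullet> v) *\<^sub>R u) /\<^sub>R sin (ang u v)"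
  have "u \<bullet> u = 1" using u by (simp add: dot_square_norm)
  then have "norm ?w = 1" "u \<bullet> ?w = 0"
    using False norm_reject_unit[OF u v] sin_ang_nonneg[of u v] by (simp_all add: inner_diff_right)
  moreover have "v = great_arc u ?w (ang u v)"
    using False u v by (simp add: great_arc_def cos_ang)
  ultimately show ?thesis using that by blast
next
  \<comment> \<open>Here \<open>v\<close> is \<open>u\<close> or \<open>- u\<close>, so any
    orthogonal unit vector serves as direction; dimension at least 2 provides one.\<close>
  case True
  obtain y where y: "y \<noteq> 0" "orthogonal u y"
    using orthogonal_to_vector_exists[OF assms(1)] by blast
  have "norm (y /\<^sub>R norm y) = 1" "u \<bullet> (y /\<^sub>R norm y) = 0"
    using y by (simp_all add: orthogonal_def)
  moreover have "v = great_arc u (y /\<^sub>R norm y) (ang u v)"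
    using True norm_reject_unit[OF u v] u v by (simp add: great_arc_def cos_ang)
  ultimately show ?thesis using that by blast
qed

context
  fixes u w :: "'a::real_inner"
  assumes uw: "norm u = 1" "norm w = 1" "u \<bullet> w = 0"
begin

lemma inner_great_arc: "great_arc u w s \<bullet> great_arc u w t = cos (t - s)"
proof -
  have "u \<bullet> u = 1" "w \<bullet> w = 1" "w \<bullet> u = 0"
    using uw by (simp_all add: dot_square_norm inner_commute)
  then show ?thesis
    using uw by (simp add: great_arc_def inner_add_left inner_add_right cos_diff mult.commute)
qed

lemma norm_great_arc: "norm (great_arc u w t) = 1"
  by (simp add: norm_eq_sqrt_inner inner_great_arc)

lemma ang_great_arc: "0 \<le> t - s \<Longrightarrow> t - s \<le> pi \<Longrightarrow> ang (great_arc u w s) (great_arc u w t) = t - s"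
  by (simp add: ang_def norm_great_arc inner_great_arc arccos_cos)

end

lemma great_arc_0: "great_arc u w 0 = u"
  by (simp add: great_arc_def)

lemma continuous_on_great_arc: "continuous_on S (great_arc u w)"
  unfolding great_arc_def by (intro continuous_intros)

lemma joinable_sphere:
  fixes u v :: "'a::euclidean_space"
  assumes "2 \<le> DIM('a)" "u \<in> sphere 0 1" "v \<in> sphere 0 1"
  shows "joinable (sphere 0 1) u v (ang u v)"
proof -
  let ?a = "ang u v"
  obtain w where w: "norm w = 1" "u \<bullet> w = 0" "v = great_arc u w ?a"
    using unit_eq_great_arc[of u v] assms by auto
  have u: "norm u = 1" using assms by simp
  let ?g = "\<lambda>t. great_arc u w (?a * t)"
  have "path ?g"
    unfolding path_def by (intro continuous_on_compose2[OF continuous_on_great_arc] continuous_intros) auto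
  then have "piecewise_smooth_path ?g"
    by (intro piecewise_smooth_path_single) (auto simp: great_arc_def smooth_on_interval_arc)
  moreover have "curve_length ?g = ?a"
  proof (rule curve_length_eq)
    fix t
    \<comment> \<open>Differentiation is again a quarter turn, so the speed is constantly
      \<open>ang u v\<close>.\<close>
    show "(?g has_vector_derivative ?a *\<^sub>R great_arc u w (?a * t + pi / 2)) (at t)"
      unfolding great_arc_def sin_add cos_add
      by (auto intro!: derivative_eq_intros
          simp: has_real_derivative_iff_has_vector_derivative[symmetric] algebra_simps)
    show "norm (?a *\<^sub>R great_arc u w (?a * t + pi / 2)) = ?a"
      using norm_great_arc[OF u w(1,2)] ang_nonneg[of u v] by simp
  qed
  moreover have "path_image ?g \<subseteq> sphere 0 1"
    using norm_great_arc[OF u w(1,2)] by (auto simp: path_image_def)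
  ultimately show ?thesis
    unfolding joinable_def using w(3)
    by (intro exI[of _ ?g]) (auto simp: pathstart_def pathfinish_def great_arc_0)
qed

lemma length_dist_sphere:
  fixes u v :: "'a::euclidean_space"
  assumes "2 \<le> DIM('a)" "u \<in> sphere 0 1" "v \<in> sphere 0 1"
  shows "length_dist (sphere 0 1) u v = ang u v"
proof (rule antisym)
  show "length_dist (sphere 0 1) u v \<le> ang u v"
    by (intro length_dist_le joinable_sphere assms)
  show "ang u v \<le> length_dist (sphere 0 1) u v"
  proof (rule length_dist_ge[OF joinable_sphere[OF assms]])
    fix g :: "real \<Rightarrow> 'a"
    assume "piecewise_smooth_path g" "path_image g \<subseteq> sphere 0 1" "pathstart g = u" "pathfinish g = v"
    then show "ang u v \<le> curve_length g"
      using ang_le_curve_length[of g] by (auto simp: path_image_def image_subset_iff)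
  qed
qed

section \<open>Closed covers of an interval and the length distance of the cube\<close>

text \<open>
  A path covered by finitely many closed sets can be cut into one piece per set: leave each set for
  the next one at the last time it is visited.
\<close>

lemma finite_closed_cover_chain:
  fixes R :: "real \<Rightarrow> real \<Rightarrow> bool"
  assumes "finite J" "{a..b} \<subseteq> (\<Union>j\<in>J. A j)" "a \<le> b"
    and closed: "\<And>j. closed (A j)"
    and trans: "\<And>x y z. R x y \<Longrightarrow> R y z \<Longrightarrow> R x z"
    and step: "\<And>j x y. x \<in> A j \<Longrightarrow> y \<in> A j \<Longrightarrow> x \<le> y \<Longrightarrow> R x y"
  shows "R a b"
  using assms(1-3)
proof (induction J arbitrary: a rule: finite_psubset_induct)
  case (psubset J)
  have "a \<in> (\<Union>j\<in>J. A j)" by (rule subsetD[OF psubset.prems(1)]) (use psubset.prems(2) in simp)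
  then obtain j where j: "j \<in> J" "a \<in> A j" by blast
  define s where "s = Sup (A j \<inter> {a..b})"
  have bdd: "bdd_above (A j \<inter> {a..b})" by (rule bdd_aboveI[of _ b]) auto
  have "s \<in> A j \<inter> {a..b}"
    unfolding s_def
  proof (rule closed_contains_Sup[OF _ bdd])
    show "A j \<inter> {a..b} \<noteq> {}" using j(2) psubset.prems(2) by auto
    show "closed (A j \<inter> {a..b})" using closed by (intro closed_Int closed_atLeastAtMost)
  qed
  then have s: "s \<in> A j" "a \<le> s" "s \<le> b" by auto
  have Ras: "R a s" using step[OF j(2) s(1,2)] .
  show ?case
  proof (cases "s = b")
    case False
    \<comment> \<open>After the last visit to \<open>A j\<close> the other sets cover the open
      interval up to \<open>b\<close>. Their finite union is closed and so contains both ends, and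
      the induction hypothesis applies from \<open>s\<close> on with a smaller family.\<close>
    have "{s<..<b} \<subseteq> (\<Union>i\<in>J - {j}. A i)"
    proof
      fix x assume x: "x \<in> {s<..<b}"
      have "x \<notin> A j"
      proof
        assume "x \<in> A j"
        then have "x \<le> s" unfolding s_def using x s(2) by (intro cSup_upper bdd) auto
        then show False using x by simp
      qed
      moreover have "x \<in> (\<Union>i\<in>J. A i)"
        by (rule subsetD[OF psubset.prems(1)]) (use s(2) x in simp)
      ultimately show "x \<in> (\<Union>i\<in>J - {j}. A i)" by auto
    qed
    moreover have "closed (\<Union>i\<in>J - {j}. A i)"
      using psubset.hyps closed by (intro closed_UN ballI finite_Diff)
    ultimately have "closure {s<..<b} \<subseteq> (\<Union>i\<in>J - {j}. A i)"
      by (rule closure_minimal)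
    then have "{s..b} \<subseteq> (\<Union>i\<in>J - {j}. A i)"
      using closure_greaterThanLessThan[of s b] s(3) False by fastforce
    then have "R s b"
      using psubset.IH[of "J - {j}" s] j(1) s(3) by blast
    with Ras show ?thesis by (rule trans)
  next
    case True
    with Ras show ?thesis by blast
  qed
qed

text \<open>The lower bound is attained at face centres, the upper one, \<open>sqrt 4\<close>, at
  vertices. That a product of two norms is at most 4 is the source of the factor 4.\<close>

lemma cube_norm_bounds:
  assumes "p \<in> cube_S3"
  shows "1 \<le> norm p" "norm p \<le> 2"
proof -
  obtain i where i: "\<bar>p $ i\<bar> = 1" and le: "\<And>j. \<bar>p $ j\<bar> \<le> 1"
    using assms by (auto simp: cube_S3_eq)
  show "1 \<le> norm p" using component_le_norm_cart[of p i] i by simp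
  have "(\<Sum>j\<in>UNIV. (p $ j)\<^sup>2) \<le> of_nat (card (UNIV :: 4 set)) * 1"
    by (rule sum_bounded_above) (use le in \<open>simp add: abs_square_le_1\<close>)
  then have "norm p \<le> sqrt 4"
    unfolding norm_vec_def L2_set_def by (intro real_sqrt_le_mono) simp
  then show "norm p \<le> 2" by simp
qed

text \<open>
  The distance from the origin to the line through two points of a face is at least 1, so the area
  \<open>norm p * norm q * sin (ang p q)\<close> of the parallelogram they span is at least \<open>norm (q - p)\<close>.
\<close>

lemma cube_face:
  assumes p: "p \<in> cube_S3" and q: "q \<in> cube_S3" and face: "p $ i = c" "q $ i = c" "\<bar>c\<bar> = 1"
  shows "closed_segment p q \<subseteq> cube_S3" "norm (q - p) \<le> 4 * ang p q"
proof -
  \<comment> \<open>This holds for every real \<open>t\<close>: the foot of the perpendicular used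
    below may lie outside the segment.\<close>
  have pi: "(p + t *\<^sub>R (q - p)) $ i = c" for t
    using face by simp
  show "closed_segment p q \<subseteq> cube_S3"
  proof
    fix x assume x: "x \<in> closed_segment p q"
    have "x \<in> cbox (-1) 1"
      using closed_segment_subset[OF _ _ convex_box(1), of p "-1" 1 q] p q x
      by (auto simp: cube_S3_eq mem_box_cart abs_le_iff minus_le_iff)
    moreover obtain t where "x = (1 - t) *\<^sub>R p + t *\<^sub>R q"
      using x by (auto simp: closed_segment_def)
    then have "x = p + t *\<^sub>R (q - p)" by (simp add: algebra_simps)
    then have "x $ i = c" using pi[of t] by simp
    ultimately show "x \<in> cube_S3"
      using face(3) by (auto simp: cube_S3_eq mem_box_cart abs_le_iff minus_le_iff)
  qed
  show "norm (q - p) \<le> 4 * ang p q"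
  proof (cases "p = q")
    case False
    define d where "d = q - p"
    have d: "d \<bullet> d > 0" using False by (simp add: d_def)
    \<comment> \<open>The parameter of the point of the line closest to the origin.\<close>
    define t where "t = - (p \<bullet> d) / (d \<bullet> d)"
    have "1 \<le> norm (p + t *\<^sub>R d)"
      using component_le_norm_cart[of "p + t *\<^sub>R d" i] pi[of t] face(3) unfolding d_def by simp
    then have "1 \<le> (p + t *\<^sub>R d) \<bullet> (p + t *\<^sub>R d)"
      by (simp add: dot_square_norm one_le_power)
    also have "\<dots> = p \<bullet> p + 2 * t * (p \<bullet> d) + t * (t * (d \<bullet> d))"
      by (simp add: inner_add_left inner_add_right inner_commute)
    also have "t * (d \<bullet> d) = - (p \<bullet> d)" using d by (simp add: t_def)
    finally have "1 \<le> p \<bullet> p + t * (p \<bullet> d)" by simp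
    then have "d \<bullet> d \<le> (p \<bullet> p + t * (p \<bullet> d)) * (d \<bullet> d)"
      using d by simp
    also have "\<dots> = (p \<bullet> p) * (d \<bullet> d) - (p \<bullet> d)\<^sup>2"
      using d by (simp add: t_def field_simps power2_eq_square)
    \<comment> \<open>The Gram determinant is unchanged when \<open>q - p\<close> is replaced by
      \<open>q\<close>.\<close>
    also have "\<dots> = (p \<bullet> p) * (q \<bullet> q) - (p \<bullet> q)\<^sup>2"
      by (simp add: d_def inner_diff_left inner_diff_right inner_commute power2_eq_square algebra_simps)
    also have "\<dots> = (norm p * norm q * sin (ang p q))\<^sup>2"
      unfolding inner_eq_cos_ang[of p q] power_mult_distrib sin_squared_eq
      by (simp add: dot_square_norm algebra_simps)
    finally have "(norm d)\<^sup>2 \<le> (norm p * norm q * sin (ang p q))\<^sup>2"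
      by (simp add: dot_square_norm)
    then have "norm d \<le> norm p * norm q * sin (ang p q)"
      by (rule power2_le_imp_le) (simp add: sin_ang_nonneg)
    also have "\<dots> \<le> 2 * 2 * ang p q"
      using cube_norm_bounds[OF p] cube_norm_bounds[OF q]
      by (intro mult_mono sin_x_le_x ang_nonneg sin_ang_nonneg) auto
    finally show ?thesis by (simp add: d_def)
  qed (simp add: ang_nonneg)
qed

lemma infnorm_attained: "\<exists>i. \<bar>x $ i\<bar> = infnorm x"
  for x :: "real^'n"
proof -
  have "infnorm x \<in> (\<lambda>i. \<bar>x \<bullet> i\<bar>) ` Basis"
    unfolding infnorm_Max by (rule Max_in) auto
  then show ?thesis by (auto simp: Basis_vec_def inner_axis)
qed

text \<open>This turns radial projection to the cube into division by
  \<open>infnorm\<close>.\<close>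

lemma cube_eq_infnorm: "cube_S3 = {x. infnorm x = 1}"
proof (intro set_eqI iffI)
  fix x :: "real^4"
  obtain i where i: "\<bar>x $ i\<bar> = infnorm x" using infnorm_attained by blast
  show "x \<in> {x. infnorm x = 1}" if "x \<in> cube_S3"
  proof -
    obtain j where "\<bar>x $ j\<bar> = 1" "\<bar>x $ i\<bar> \<le> 1" using \<open>x \<in> cube_S3\<close> by (auto simp: cube_S3_eq)
    then show ?thesis using component_le_infnorm_cart[of x j] i by simp
  qed
  show "x \<in> cube_S3" if "x \<in> {x. infnorm x = 1}"
    using that i component_le_infnorm_cart[of x] by (auto simp: cube_S3_eq)
qed

text \<open>
  The great circle arc from \<open>p / norm p\<close> to \<open>q / norm q\<close>, projected radially to the cube, meets the
  eight faces in finitely many pieces; each of them is replaced by a chord.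
\<close>

lemma joinable_cube:
  assumes p: "p \<in> cube_S3" and q: "q \<in> cube_S3"
  shows "joinable cube_S3 p q (4 * ang p q)"
proof -
  define u v where "u = p /\<^sub>R norm p" and "v = q /\<^sub>R norm q"
  have pos: "0 < norm p" "0 < norm q" using cube_norm_bounds p q by fastforce+
  have u: "norm u = 1" and v: "norm v = 1" using pos by (auto simp: u_def v_def)
  have a: "ang u v = ang p q" using pos by (simp add: u_def v_def ang_scale)
  obtain w where w: "norm w = 1" "u \<bullet> w = 0" "v = great_arc u w (ang p q)"
    using unit_eq_great_arc[of u v] u v a by auto
  let ?\<gamma> = "great_arc u w" and ?P = "\<lambda>x::real^4. x /\<^sub>R infnorm x"
  let ?c = "\<lambda>\<sigma>. if \<sigma> then 1 else (-1::real)"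
  \<comment> \<open>The parameters at which the arc points into the face with index \<open>i\<close>
    and sign \<open>\<sigma>\<close>: a coordinate whose signed value is the maximum norm becomes
    that sign after projection.\<close>
  let ?A = "\<lambda>(i, \<sigma>). {t \<in> {0..ang p q}. ?c \<sigma> * ?\<gamma> t $ i = infnorm (?\<gamma> t)}"
  have n\<gamma>: "norm (?\<gamma> t) = 1" for t by (rule norm_great_arc[OF u w(1,2)])
  then have pos\<gamma>: "0 < infnorm (?\<gamma> t)" for t
    by (metis infnorm_pos_lt norm_zero zero_neq_one)
  have P\<gamma>: "?P (?\<gamma> t) \<in> cube_S3" for t
    using pos\<gamma>[of t] by (simp add: cube_eq_infnorm infnorm_mul)
  \<comment> \<open>The length bound is additive in the parameter, which makes this relation
    transitive.\<close>
  let ?R = "\<lambda>x y. joinable cube_S3 (?P (?\<gamma> x)) (?P (?\<gamma> y)) (4 * (y - x))"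
  have "?R 0 (ang p q)"
  proof (rule finite_closed_cover_chain[where J = UNIV and A = ?A and R = ?R])
    show "{0..ang p q} \<subseteq> (\<Union>j. ?A j)"
    proof
      fix t assume t: "t \<in> {0..ang p q}"
      obtain i where "\<bar>?\<gamma> t $ i\<bar> = infnorm (?\<gamma> t)" using infnorm_attained by blast
      then have "t \<in> ?A (i, ?\<gamma> t $ i \<ge> 0)" using t by auto
      then show "t \<in> (\<Union>j. ?A j)" by blast
    qed
    show "closed (?A j)" for j
    proof (cases j)
      case (Pair i \<sigma>)
      have "closed ({0..ang p q} \<inter> {t. ?c \<sigma> * ?\<gamma> t $ i = infnorm (?\<gamma> t)})"
        by (intro closed_Int closed_Collect_eq continuous_intros continuous_on_great_arc)
      then show ?thesis by (simp add: Pair Int_def)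
    qed
    show "?R x z" if "?R x y" "?R y z" for x y z
      using joinable_trans[OF that] by (simp add: algebra_simps)
    show "?R x y" if xy: "x \<in> ?A j" "y \<in> ?A j" "x \<le> y" for j x y
    proof (cases j)
      case (Pair i \<sigma>)
      have "?P (?\<gamma> x) $ i = ?c \<sigma>" "?P (?\<gamma> y) $ i = ?c \<sigma>"
        using xy(1,2) pos\<gamma>[of x] pos\<gamma>[of y] by (auto simp: Pair field_simps split: if_splits)
      note f = cube_face[OF P\<gamma> P\<gamma> this]
      have "ang (?P (?\<gamma> x)) (?P (?\<gamma> y)) = ang (?\<gamma> x) (?\<gamma> y)"
        using pos\<gamma> by (simp add: ang_scale)
      \<comment> \<open>The whole arc is at most pi long, so angles between its points are parameter
        differences.\<close>
      also have "\<dots> = y - x"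
        using xy ang_le_pi[of p q] by (intro ang_great_arc[OF u w(1,2)]) (auto simp: Pair)
      finally have "norm (?P (?\<gamma> y) - ?P (?\<gamma> x)) \<le> 4 * (y - x)"
        using f(2) by simp
      moreover have "joinable cube_S3 (?P (?\<gamma> x)) (?P (?\<gamma> y)) (norm (?P (?\<gamma> y) - ?P (?\<gamma> x)))"
        using f(1) by (intro joinable_segment) simp
      ultimately show ?thesis unfolding joinable_def by (meson order_trans)
    qed
  qed (simp_all add: ang_nonneg)
  moreover have "?P u = p" "?P v = q"
    using p q pos by (simp_all add: u_def v_def infnorm_mul cube_eq_infnorm)
  ultimately show ?thesis unfolding w(3)[symmetric] great_arc_0 by simp
qed

text \<open>The first bound holds because the cube lies outside the open unit ball. The chord bound
  is exact within one face and makes distances between distinct points positive.\<close>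

lemma length_dist_cube_bounds:
  assumes p: "p \<in> cube_S3" and q: "q \<in> cube_S3"
  shows "ang p q \<le> length_dist cube_S3 p q" "length_dist cube_S3 p q \<le> 4 * ang p q"
    and "norm (q - p) \<le> length_dist cube_S3 p q"
proof -
  note j = joinable_cube[OF p q]
  show "length_dist cube_S3 p q \<le> 4 * ang p q" using j by (rule length_dist_le)
  show "ang p q \<le> length_dist cube_S3 p q"
  proof (rule length_dist_ge[OF j])
    fix g assume "piecewise_smooth_path g" "path_image g \<subseteq> cube_S3" "pathstart g = p" "pathfinish g = q"
    then show "ang p q \<le> curve_length g"
      using ang_le_curve_length[of g] cube_norm_bounds(1) by (auto simp: path_image_def image_subset_iff)
  qed
  show "norm (q - p) \<le> length_dist cube_S3 p q"
    by (rule length_dist_ge[OF j]) (use norm_diff_le_curve_length in blast)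
qed

lemma length_dist_mu3:
  assumes "p \<in> cube_S3" "q \<in> cube_S3"
  shows "length_dist S3 (mu3 p) (mu3 q) = ang p q"
proof -
  have "0 < norm p" "0 < norm q" using cube_norm_bounds assms by fastforce+
  then show ?thesis
    by (subst length_dist_sphere) (auto simp: mu3_def ang_scale)
qed

section \<open>Distortion along the diagonal of a face\<close>

definition face_diagonal :: "real \<Rightarrow> real^4" where
  "face_diagonal s = (\<chi> i. if i = 1 then 1 else s)"

lemma inner_face_diagonal: "face_diagonal s \<bullet> face_diagonal t = 1 + 3 * (s * t)"
  by (simp add: inner_vec_def face_diagonal_def sum_4)

lemma norm_face_diagonal_diff: "norm (face_diagonal t - face_diagonal s) = sqrt 3 * \<bar>t - s\<bar>"
proof -
  have "(face_diagonal t - face_diagonal s) \<bullet> (face_diagonal t - face_diagonal s) = 3 * (t - s)\<^sup>2"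
    by (simp add: inner_diff_left inner_diff_right inner_face_diagonal power2_eq_square algebra_simps)
  then show ?thesis by (simp add: norm_eq_sqrt_inner real_sqrt_mult)
qed

lemma face_diagonal_in_cube: "s \<in> {0..1} \<Longrightarrow> face_diagonal s \<in> cube_S3"
  by (auto simp: cube_S3_eq face_diagonal_def)

text \<open>The offset from the face centre has length \<open>sqrt 3 * s\<close>, and the face is at
  distance 1 from the origin, so \<open>arctan (sqrt 3 * s)\<close> is the angle to the centre. The
  points lie in one plane on the same side of the axis, so these angles subtract.\<close>

lemma ang_face_diagonal:
  assumes "0 \<le> s" "0 \<le> t"
  shows "ang (face_diagonal s) (face_diagonal t) = \<bar>arctan (sqrt 3 * t) - arctan (sqrt 3 * s)\<bar>"
proof -
  let ?x = "sqrt 3 * s" and ?y = "sqrt 3 * t"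
  have e: "sqrt 3 * a * (sqrt 3 * b) = 3 * (a * b)" for a b
  proof -
    have "sqrt 3 * a * (sqrt 3 * b) = sqrt 3 * sqrt 3 * (a * b)" by (simp only: ac_simps)
    then show ?thesis by simp
  qed
  have "cos (arctan ?y - arctan ?x) = (1 + ?x * ?y) / (sqrt (1 + ?x\<^sup>2) * sqrt (1 + ?y\<^sup>2))"
    by (simp add: cos_diff cos_arctan sin_arctan add_divide_distrib mult.commute)
  also have "\<dots> = face_diagonal s \<bullet> face_diagonal t / (norm (face_diagonal s) * norm (face_diagonal t))"
    by (simp add: norm_eq_sqrt_inner inner_face_diagonal power2_eq_square e)
  finally have "ang (face_diagonal s) (face_diagonal t) = arccos (cos (arctan ?y - arctan ?x))"
    by (simp add: ang_def)
  moreover have "\<bar>arctan ?y - arctan ?x\<bar> \<le> pi"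
    using arctan_lbound[of ?x] arctan_ubound[of ?x] arctan_lbound[of ?y] arctan_ubound[of ?y] by linarith
  ultimately show ?thesis by (simp add: arccos_cos_eq_abs)
qed

text \<open>The straight segment stays in the face, and no curve is shorter than its chord.\<close>

lemma length_dist_face_diagonal:
  assumes "s \<in> {0..1}" "t \<in> {0..1}"
  shows "length_dist cube_S3 (face_diagonal s) (face_diagonal t) = sqrt 3 * \<bar>t - s\<bar>"
proof (rule antisym)
  note c = face_diagonal_in_cube[OF assms(1)] face_diagonal_in_cube[OF assms(2)]
  have "closed_segment (face_diagonal s) (face_diagonal t) \<subseteq> cube_S3"
    by (rule cube_face(1)[OF c, of 1 1]) (auto simp: face_diagonal_def)
  from length_dist_le[OF joinable_segment[OF this]]
  show "length_dist cube_S3 (face_diagonal s) (face_diagonal t) \<le> sqrt 3 * \<bar>t - s\<bar>"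
    by (simp add: norm_face_diagonal_diff)
  show "sqrt 3 * \<bar>t - s\<bar> \<le> length_dist cube_S3 (face_diagonal s) (face_diagonal t)"
    using length_dist_cube_bounds(3)[OF c] by (simp add: norm_face_diagonal_diff)
qed

text \<open>
  The value \<open>1 / (1 + 3 * s\<^sup>2)\<close> is the infinitesimal distortion at \<open>face_diagonal s\<close> along the diagonal.
\<close>

lemma diagonal_ratio_in_distortion_range:
  assumes s: "s \<in> {0..1}"
  shows "1 / (1 + 3 * s\<^sup>2) \<in> distortion_range cube_S3 (length_dist cube_S3) (length_dist S3) mu3"
    (is "_ \<in> ?D")
proof -
  \<comment> \<open>The distortion ratio of \<open>face_diagonal s\<close> and
    \<open>face_diagonal t\<close> is the absolute difference quotient of this function, so its
    derivative is the limiting ratio.\<close>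
  let ?f = "\<lambda>t. arctan (sqrt 3 * t) / sqrt 3"
  have "(?f has_real_derivative inverse (1 + (sqrt 3 * s)\<^sup>2) * sqrt 3 / sqrt 3) (at s)"
    by (auto intro!: derivative_eq_intros)
  then have "(?f has_real_derivative 1 / (1 + 3 * s\<^sup>2)) (at s)"
    by (simp add: power_mult_distrib inverse_eq_divide)
  then have "(?f has_real_derivative 1 / (1 + 3 * s\<^sup>2)) (at s within {0..1})"
    by (rule has_field_derivative_at_within)
  then have "((\<lambda>t. (?f t - ?f s) / (t - s)) \<longlongrightarrow> 1 / (1 + 3 * s\<^sup>2)) (at s within {0..1})"
    by (simp add: has_field_derivative_iff)
  then have "((\<lambda>t. \<bar>(?f t - ?f s) / (t - s)\<bar>) \<longlongrightarrow> \<bar>1 / (1 + 3 * s\<^sup>2)\<bar>) (at s within {0..1})"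
    by (rule tendsto_rabs)
  then have lim: "((\<lambda>t. \<bar>(?f t - ?f s) / (t - s)\<bar>) \<longlongrightarrow> 1 / (1 + 3 * s\<^sup>2)) (at s within {0..1})"
    by (simp add: abs_of_pos add_pos_nonneg)
  have ev: "\<forall>\<^sub>F t in at s within {0..1}. \<bar>(?f t - ?f s) / (t - s)\<bar> \<in> ?D"
  proof (rule eventually_at_filter[THEN iffD2], rule always_eventually, intro allI impI)
    fix t :: real assume t: "t \<noteq> s" "t \<in> {0..1}"
    let ?p = "face_diagonal s" and ?q = "face_diagonal t"
    have "norm (?q - ?p) \<noteq> 0" using t by (simp add: norm_face_diagonal_diff)
    then have "?p \<noteq> ?q" by auto
    moreover have "?p \<in> cube_S3" "?q \<in> cube_S3" using s t by (auto intro: face_diagonal_in_cube)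
    ultimately have "length_dist S3 (mu3 ?p) (mu3 ?q) / length_dist cube_S3 ?p ?q \<in> ?D"
      unfolding distortion_range_def by (intro closure_subset[THEN subsetD] CollectI exI[of _ ?p] exI[of _ ?q] conjI refl)
    moreover have "length_dist S3 (mu3 ?p) (mu3 ?q) / length_dist cube_S3 ?p ?q = \<bar>(?f t - ?f s) / (t - s)\<bar>"
      using s t \<open>?p \<in> cube_S3\<close> \<open>?q \<in> cube_S3\<close>
      by (simp add: length_dist_mu3 length_dist_face_diagonal ang_face_diagonal abs_divide
          abs_mult diff_divide_distrib[symmetric])
    ultimately show "\<bar>(?f t - ?f s) / (t - s)\<bar> \<in> ?D" by simp
  qed
  have closed: "closed ?D" by (simp add: distortion_range_def)
  \<comment> \<open>Restricting to the interval keeps \<open>t\<close> on the diagonal; at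
    \<open>s = 0\<close> and \<open>s = 1\<close> the limit is one-sided.\<close>
  have nontrivial: "at s within {0..1} \<noteq> bot"
    using s by (simp add: trivial_limit_within islimpt_Icc)
  show ?thesis by (rule Lim_in_closed_set[OF closed ev nontrivial lim])
qed

section \<open>The distortion range and the distortion constant\<close>

lemma distortion_range_mu3:
  "distortion_range cube_S3 (length_dist cube_S3) (length_dist S3) mu3 = {1/4..1}"
proof (rule antisym)
  have "length_dist S3 (mu3 p) (mu3 q) / length_dist cube_S3 p q \<in> {1/4..1}"
    if pq: "p \<in> cube_S3" "q \<in> cube_S3" "p \<noteq> q" for p q
  proof -
    have "0 < norm (q - p)" using pq by simp
    then have "0 < length_dist cube_S3 p q" using length_dist_cube_bounds(3)[OF pq(1,2)] by linarith
    then show ?thesis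
      using length_dist_cube_bounds(1,2)[OF pq(1,2)] pq by (simp add: length_dist_mu3 field_simps)
  qed
  then show "distortion_range cube_S3 (length_dist cube_S3) (length_dist S3) mu3 \<subseteq> {1/4..1}"
    unfolding distortion_range_def by (intro closure_minimal) auto
  show "{1/4..1} \<subseteq> distortion_range cube_S3 (length_dist cube_S3) (length_dist S3) mu3"
  proof
    fix r :: real assume r: "r \<in> {1/4..1}"
    \<comment> \<open>Solves \<open>1 / (1 + 3 * s\<^sup>2) = r\<close> for \<open>s\<close>; the
      bounds on \<open>r\<close> put the root between 0 and 1.\<close>
    let ?s = "sqrt ((1 / r - 1) / 3)"
    have "0 \<le> (1 / r - 1) / 3" "(1 / r - 1) / 3 \<le> 1" using r by (auto simp: field_simps)
    then have "?s \<in> {0..1}" "?s\<^sup>2 = (1 / r - 1) / 3" by auto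
    moreover from this(2) have "1 + 3 * ?s\<^sup>2 = 1 / r" by (simp add: field_simps)
    then have "1 / (1 + 3 * ?s\<^sup>2) = r" by simp
    ultimately show "r \<in> distortion_range cube_S3 (length_dist cube_S3) (length_dist S3) mu3"
      using diagonal_ratio_in_distortion_range by metis
  qed
qed

theorem theorem1:
  shows "distortion_range cube_S3 (length_dist cube_S3) (length_dist S3) mu3 = {1/4..1} \<and>
         distortion_constant cube_S3 (length_dist cube_S3) (length_dist S3) mu3 = 4"
  using distortion_range_mu3 distortion_constant_eq[OF _ _ distortion_range_mu3] by simp

end
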